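(* Let $\mathcal{X}\in\mathbb{R}^{I_1\times\cdots\times I_M\times n}$ be a data tensor, let $W=(w_{i,j})\in\mathbb{R}^{n\times n}$ be a weight matrix, and let $1\le d\le I_1\cdots I_M$. Consider the problem of minimizing $$\Phi_{ONPP}(\mathcal{Y})=\sum_{i=1}^n\Big\|\mathcal{Y}^{(i)}-\sum_{j=1}^n w_{i,j}\mathcal{Y}^{(j)}\Big\|_F^2,\qquad \mathcal{Y}=\mathcal{P}^\top *_M\mathcal{X}\in\mathbb{R}^{d\times n},$$ over all $\mathcal{P}\in\mathbb{R}^{I_1\times\cdots\times I_M\times d}$ with $\mathcal{P}^\top *_M\mathcal{P}=\mathcal{I}$. A solution is given by the tensor $\mathcal{P}$ whose $d$ frontal slices are the smallest $d$ left singular tensors of $\mathcal{X}\times_{M+1}(I_n-W)$.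
   Context: The frontal slice $\mathcal{A}^{(i)}$ of a tensor is obtained by fixing its last index to $i$. The Einstein product $*_N$ contracts the last $N$ modes of the first tensor with the first $N$ modes of the second: $(\mathcal{A}*_N\mathcal{B})_{i_1\ldots i_p j_1\ldots j_q}=\sum_{k_1,\ldots,k_N}\mathcal{A}_{i_1\ldots i_pk_1\ldots k_N}\mathcal{B}_{k_1\ldots k_Nj_1\ldots j_q}$. For $\mathcal{P}\in\mathbb{R}^{I_1\times\cdots\times I_M\times d}$, the transpose $\mathcal{P}^\top\in\mathbb{R}^{d\times I_1\times\cdots\times I_M}$ has entries $(\mathcal{P}^\top)_{k i_1\ldots i_M}=\mathcal{P}_{i_1\ldots i_M k}$; in general $\mathcal{A}\in\mathbb{R}^{I_1\times\cdots\times I_M\times J_1\times\cdots\times J_N}$ has transpose $(\mathcal{A}^\top)_{j_1\ldots j_Ni_1\ldots i_M}=\mathcal{A}_{i_1\ldots i_Mj_1\ldots j_N}$. $\mathcal{I}$ denotes the identity tensor (here the $d\times d$ identity matrix), $I_n$ the $n\times n$ identity matrix. $\|\cdot\|_F$ is the Frobenius norm. The $m$-mode product of $\mathcal{A}$ with a matrix $U$ is $(\mathcal{A}\times_mU)_{i_1\ldots i_{m-1}ji_{m+1}\ldots}=\sum_{i_m}U_{ji_m}\mathcal{A}_{i_1\ldots i_m\ldots}$. The Einstein SVD (E-SVD) of $\mathcal{A}\in\mathbb{R}^{I_1\times\cdots\times I_M\times K_1\times\cdots\times K_N}$ is a factorization $\mathcal{A}=\mathcal{U}*_M\mathcal{S}*_N\mathcal{V}^\top$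 with $\mathcal{U}\in\mathbb{R}^{I_1\times\cdots\times I_M\times I_1\times\cdots\times I_M}$ and $\mathcal{V}\in\mathbb{R}^{K_1\times\cdots\times K_N\times K_1\times\cdots\times K_N}$ unitary ($\mathcal{U}^\top*_M\mathcal{U}=\mathcal{U}*_M\mathcal{U}^\top=\mathcal{I}$, likewise $\mathcal{V}$), and $\mathcal{S}\ge0$ diagonal-like: for each multi-index $(i_1,\ldots,i_M)$ at most one entry $\mathcal{S}_{i_1\ldots i_Mk_1\ldots k_N}$ is nonzero, and likewise for each multi-index $(k_1,\dots,k_N)$. The left singular tensors are the slices $\mathcal{U}_{:\ldots:i_1\ldots i_M}$; the singular value associated with this slice is the nonzero entry among the $\mathcal{S}_{i_1\ldots i_Mk_1\ldots k_N}$, or $0$ if there is none. The "smallest $d$" left singular tensors are those associated with the $d$ smallest singular values, counted with multiplicity. *)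

theory Defs
  imports "Jordan_Normal_Form.Matrix"
begin

section \<open>Real tensors of arbitrary order\<close>

text \<open>Multi-indices are lists and every index is 0-based. A tensor carries its dimensions and is 0
  outside its index range, so that equality of tensors is equality of dimensions and entries.\<close>

definition multi_indices :: "nat list \<Rightarrow> nat list set" where
  "multi_indices ds = {is. list_all2 (<) is ds}"

typedef tensor = "{(ds :: nat list, f :: nat list \<Rightarrow> real). \<forall>is. is \<notin> multi_indices ds \<longrightarrow> f is = 0}"
  by (rule exI[of _ "([], \<lambda>_. 0)"]) simp

setup_lifting type_definition_tensor

lift_definition tensor :: "nat list \<Rightarrow> (nat list \<Rightarrow> real) \<Rightarrow> tensor" is
  "\<lambda>ds f. (ds, \<lambda>is. if is \<in> multi_indices ds then f is else 0)"
  by auto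

lift_definition dims :: "tensor \<Rightarrow> nat list" is fst .

lift_definition entry :: "tensor \<Rightarrow> nat list \<Rightarrow> real" is snd .

definition carrier_tensor :: "nat list \<Rightarrow> tensor set" where
  "carrier_tensor ds = {A. dims A = ds}"

lemma dims_tensor [simp]: "dims (tensor ds f) = ds"
  by transfer simp

lemma entry_tensor: "entry (tensor ds f) is = (if is \<in> multi_indices ds then f is else 0)"
  by transfer simp

lemma tensor_eqI:
  assumes "dims A = dims B" and "\<And>is. is \<in> multi_indices (dims A) \<Longrightarrow> entry A is = entry B is"
  shows "A = B"
  using assms
proof transfer
  fix A B :: "nat list \<times> (nat list \<Rightarrow> real)"
  assume A: "A \<in> {(ds, f). \<forall>is. is \<notin> multi_indices ds \<longrightarrow> f is = 0}"
    and B: "B \<in> {(ds, f). \<forall>is. is \<notin> multi_indices ds \<longrightarrow> f is = 0}"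
    and d: "fst A = fst B"
    and e: "\<And>is. is \<in> multi_indices (fst A) \<Longrightarrow> snd A is = snd B is"
  have "snd A is = snd B is" for "is"
    using A B d e[of "is"] by (cases "is \<in> multi_indices (fst A)") (simp_all add: case_prod_beta)
  with d show "A = B" by (simp add: prod_eq_iff fun_eq_iff)
qed

lemma multi_indices_append:
  assumes "is \<in> multi_indices ds" and "js \<in> multi_indices es"
  shows "is @ js \<in> multi_indices (ds @ es)"
  using assms unfolding multi_indices_def by (auto intro: list_all2_appendI)

lemma length_multi_indices: "is \<in> multi_indices ds \<Longrightarrow> length is = length ds"
  unfolding multi_indices_def by (auto dest: list_all2_lengthD)


section \<open>Tensor operations\<close>

definition minus_tensor :: "tensor \<Rightarrow> tensor \<Rightarrow> tensor" where
  "minus_tensor A B = tensor (dims A) (\<lambda>is. entry A is - entry B is)"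

definition scale_tensor :: "real \<Rightarrow> tensor \<Rightarrow> tensor" where
  "scale_tensor c A = tensor (dims A) (\<lambda>is. c * entry A is)"

text \<open>The dimensions are an argument because an empty family does not determine them.\<close>

definition sum_tensor :: "nat list \<Rightarrow> ('a \<Rightarrow> tensor) \<Rightarrow> 'a set \<Rightarrow> tensor" where
  "sum_tensor ds F T = tensor ds (\<lambda>is. \<Sum>j\<in>T. entry (F j) is)"

definition frobenius_norm :: "tensor \<Rightarrow> real" where
  "frobenius_norm A = sqrt (\<Sum>is\<in>multi_indices (dims A). (entry A is)\<^sup>2)"

text \<open>The trailing modes are fixed to the multi-index \<open>ks\<close>.\<close>

definition trailing_slice :: "tensor \<Rightarrow> nat list \<Rightarrow> tensor" where
  "trailing_slice A ks =
     tensor (take (length (dims A) - length ks) (dims A)) (\<lambda>is. entry A (is @ ks))"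

definition frontal_slice :: "tensor \<Rightarrow> nat \<Rightarrow> tensor" where
  "frontal_slice A i = trailing_slice A [i]"

text \<open>The last \<open>N\<close> modes of \<open>A\<close> are contracted with the first \<open>N\<close> modes of \<open>B\<close>.\<close>

definition einstein_product :: "nat \<Rightarrow> tensor \<Rightarrow> tensor \<Rightarrow> tensor" where
  "einstein_product N A B = (let p = length (dims A) - N in
     tensor (take p (dims A) @ drop N (dims B))
       (\<lambda>is. \<Sum>ks\<in>multi_indices (take N (dims B)).
                entry A (take p is @ ks) * entry B (ks @ drop p is)))"

lemma entry_einstein_product:
  assumes "A \<in> carrier_tensor (Is @ Ks)" and "B \<in> carrier_tensor (Ks @ Js)"
    and "is \<in> multi_indices Is" and "js \<in> multi_indices Js"
  shows "entry (einstein_product (length Ks) A B) (is @ js) =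
    (\<Sum>ks\<in>multi_indices Ks. entry A (is @ ks) * entry B (ks @ js))"
  using assms multi_indices_append[OF assms(3,4)] length_multi_indices[OF assms(3)]
  by (simp add: einstein_product_def carrier_tensor_def Let_def entry_tensor)

text \<open>The first \<open>M\<close> modes are moved behind the remaining ones.\<close>

definition transpose_tensor :: "nat \<Rightarrow> tensor \<Rightarrow> tensor" where
  "transpose_tensor M A = tensor (drop M (dims A) @ take M (dims A))
     (\<lambda>is. entry A (drop (length is - M) is @ take (length is - M) is))"

lemma entry_transpose_tensor:
  assumes "A \<in> carrier_tensor (Is @ Js)"
    and "is \<in> multi_indices Is" and "js \<in> multi_indices Js"
  shows "entry (transpose_tensor (length Is) A) (js @ is) = entry A (is @ js)"
  using assms multi_indices_append[OF assms(3,2)] length_multi_indices[OF assms(2)]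
  by (simp add: transpose_tensor_def carrier_tensor_def entry_tensor)

text \<open>The identity of size \<open>ds \<times> ds\<close>; \<open>id_tensor [d]\<close> is the \<open>d \<times> d\<close> identity matrix.\<close>

definition id_tensor :: "nat list \<Rightarrow> tensor" where
  "id_tensor ds = tensor (ds @ ds)
     (\<lambda>is. if take (length ds) is = drop (length ds) is then 1 else 0)"

text \<open>Modes are numbered from 1, so mode \<open>m\<close> is position \<open>m - 1\<close> of the index list.\<close>

definition mode_product :: "tensor \<Rightarrow> nat \<Rightarrow> real mat \<Rightarrow> tensor" where
  "mode_product A m U = tensor ((dims A)[m - 1 := dim_row U])
     (\<lambda>is. \<Sum>k<dims A ! (m - 1). U $$ (is ! (m - 1), k) * entry A (is[m - 1 := k]))"


section \<open>The Einstein singular value decomposition\<close>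

definition unitary_tensor :: "nat list \<Rightarrow> tensor \<Rightarrow> bool" where
  "unitary_tensor ds U \<longleftrightarrow> U \<in> carrier_tensor (ds @ ds) \<and>
     einstein_product (length ds) (transpose_tensor (length ds) U) U = id_tensor ds \<and>
     einstein_product (length ds) U (transpose_tensor (length ds) U) = id_tensor ds"

definition diagonal_like :: "nat list \<Rightarrow> nat list \<Rightarrow> tensor \<Rightarrow> bool" where
  "diagonal_like Is Ks S \<longleftrightarrow>
     (\<forall>is\<in>multi_indices Is. \<forall>ks\<in>multi_indices Ks. \<forall>ks'\<in>multi_indices Ks.
        entry S (is @ ks) \<noteq> 0 \<and> entry S (is @ ks') \<noteq> 0 \<longrightarrow> ks = ks') \<and>
     (\<forall>ks\<in>multi_indices Ks. \<forall>is\<in>multi_indices Is. \<forall>is'\<in>multi_indices Is.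
        entry S (is @ ks) \<noteq> 0 \<and> entry S (is' @ ks) \<noteq> 0 \<longrightarrow> is = is')"

definition is_esvd ::
    "nat list \<Rightarrow> nat list \<Rightarrow> tensor \<Rightarrow> tensor \<Rightarrow> tensor \<Rightarrow> tensor \<Rightarrow> bool" where
  "is_esvd Is Ks A U S V \<longleftrightarrow>
     A \<in> carrier_tensor (Is @ Ks) \<and> S \<in> carrier_tensor (Is @ Ks) \<and>
     unitary_tensor Is U \<and> unitary_tensor Ks V \<and>
     (\<forall>is\<in>multi_indices (Is @ Ks). 0 \<le> entry S is) \<and> diagonal_like Is Ks S \<and>
     A = einstein_product (length Ks) (einstein_product (length Is) U S)
           (transpose_tensor (length Ks) V)"

text \<open>The singular value associated with the left singular tensor \<open>trailing_slice U is\<close>.\<close>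

definition singular_value :: "nat list \<Rightarrow> tensor \<Rightarrow> nat list \<Rightarrow> real" where
  "singular_value Ks S is =
     (if \<exists>ks\<in>multi_indices Ks. entry S (is @ ks) \<noteq> 0
      then entry S (is @ (THE ks. ks \<in> multi_indices Ks \<and> entry S (is @ ks) \<noteq> 0))
      else 0)"

text \<open>The frontal slices of \<open>P\<close> are left singular tensors of \<open>A\<close> at \<open>d\<close> distinct multi-indices whose
  singular values are the \<open>d\<close> smallest, counted with multiplicity. Neither the decomposition nor the
  choice among equal singular values is unique, and the order of the slices is not prescribed.\<close>

definition smallest_left_singular ::
    "nat list \<Rightarrow> nat list \<Rightarrow> nat \<Rightarrow> tensor \<Rightarrow> tensor \<Rightarrow> bool" where
  "smallest_left_singular Is Ks d A P \<longleftrightarrow>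
     P \<in> carrier_tensor (Is @ [d]) \<and>
     (\<exists>U S V \<sigma>. is_esvd Is Ks A U S V \<and>
        inj_on \<sigma> {..<d} \<and> \<sigma> ` {..<d} \<subseteq> multi_indices Is \<and>
        (\<forall>k<d. \<forall>is\<in>multi_indices Is - \<sigma> ` {..<d}.
           singular_value Ks S (\<sigma> k) \<le> singular_value Ks S is) \<and>
        (\<forall>k<d. frontal_slice P k = trailing_slice U (\<sigma> k)))"


section \<open>The ONPP minimization problem\<close>

definition onpp_objective :: "nat \<Rightarrow> real mat \<Rightarrow> tensor \<Rightarrow> real" where
  "onpp_objective n W Y = (\<Sum>i<n. (frobenius_norm (minus_tensor (frontal_slice Y i)
     (sum_tensor (butlast (dims Y)) (\<lambda>j. scale_tensor (W $$ (i, j)) (frontal_slice Y j)) {..<n})))\<^sup>2)"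

definition onpp_feasible :: "nat list \<Rightarrow> nat \<Rightarrow> tensor \<Rightarrow> bool" where
  "onpp_feasible Is d P \<longleftrightarrow> P \<in> carrier_tensor (Is @ [d]) \<and>
     einstein_product (length Is) (transpose_tensor (length Is) P) P = id_tensor [d]"

definition onpp_value :: "nat list \<Rightarrow> nat \<Rightarrow> tensor \<Rightarrow> real mat \<Rightarrow> tensor \<Rightarrow> real" where
  "onpp_value Is n X W P =
     onpp_objective n W (einstein_product (length Is) (transpose_tensor (length Is) P) X)"

definition onpp_solution :: "nat list \<Rightarrow> nat \<Rightarrow> nat \<Rightarrow> tensor \<Rightarrow> real mat \<Rightarrow> tensor \<Rightarrow> bool" where
  "onpp_solution Is n d X W P \<longleftrightarrow> onpp_feasible Is d P \<and>
     (\<forall>Q. onpp_feasible Is d Q \<longrightarrow> onpp_value Is n X W P \<le> onpp_value Is n X W Q)"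

end

(* Write A = X x_{M+1} (I - W). For feasible P the objective equals |P^T A|_F^2, and the E-SVD
   A = U S V^T turns it into the sum over j of s_j^2 t_j, where t_j is the squared length of the
   projection of the left singular tensor u_j to the span of the frontal slices of P. By Bessel
   0 <= t_j <= 1, and by Parseval the t_j add up to d, so the sum is at least that of the d smallest
   s_j^2; choosing the corresponding u_j as frontal slices attains it. That an E-SVD exists follows
   from a greedy construction of an orthonormal basis whose images under A are orthogonal. *)

theory Submission
  imports Defs "HOL-Analysis.Function_Topology"
begin

section \<open>Orthonormal families of functions on a finite set\<close>

text \<open>Vectors are functions seen only on a finite index set, so multi-indices serve as
  coordinates and no flattening of tensors is needed. All dimension counting rests on one identity:
  the squared distances of the standard basis vectors to the span of an orthonormal family add up to
  \<open>card K - card J\<close>. It bounds the size of a family, supplies a further unit vector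
  when the family is too small, and makes a family of full size complete. The greedy choice takes a
  maximum over a unit sphere in a function space, which calls for compactness there; the first-order
  condition at the maximum replaces eigenvectors. An E-SVD is not unique, and the theorem speaks of
  every \<open>P\<close> that arises from any of them. Optimality is therefore proved for an
  arbitrary E-SVD, and the constructed one only shows that such a \<open>P\<close> exists.\<close>

definition ip :: "'a set \<Rightarrow> ('a \<Rightarrow> real) \<Rightarrow> ('a \<Rightarrow> real) \<Rightarrow> real" where
  "ip K x y = (\<Sum>k\<in>K. x k * y k)"

definition orthonormal_on :: "'b set \<Rightarrow> 'a set \<Rightarrow> ('b \<Rightarrow> 'a \<Rightarrow> real) \<Rightarrow> bool" where
  "orthonormal_on J K u \<longleftrightarrow> (\<forall>i\<in>J. \<forall>j\<in>J. ip K (u i) (u j) = of_bool (i = j))"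

lemma orthonormal_onD:
  "orthonormal_on J K u \<Longrightarrow> i \<in> J \<Longrightarrow> j \<in> J \<Longrightarrow> ip K (u i) (u j) = of_bool (i = j)"
  by (simp add: orthonormal_on_def)

lemma ip_commute: "ip K x y = ip K y x"
  by (simp add: ip_def mult.commute)

lemma ip_add_left: "ip K (\<lambda>k. x k + y k) z = ip K x z + ip K y z"
  by (simp add: ip_def distrib_right sum.distrib)

lemma ip_diff_left: "ip K (\<lambda>k. x k - y k) z = ip K x z - ip K y z"
  by (simp add: ip_def left_diff_distrib sum_subtractf)

lemma ip_scale_left: "ip K (\<lambda>k. c * x k) z = c * ip K x z"
  by (simp add: ip_def sum_distrib_left mult.assoc)

lemma ip_sum_left: "ip K (\<lambda>k. \<Sum>j\<in>J. F j k) z = (\<Sum>j\<in>J. ip K (F j) z)"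
  unfolding ip_def by (subst sum.swap) (simp add: sum_distrib_right)

lemma ip_add_right: "ip K z (\<lambda>k. x k + y k) = ip K z x + ip K z y"
  by (metis ip_add_left ip_commute)

lemma ip_diff_right: "ip K z (\<lambda>k. x k - y k) = ip K z x - ip K z y"
  by (metis ip_diff_left ip_commute)

lemma ip_scale_right: "ip K z (\<lambda>k. c * x k) = c * ip K z x"
  by (metis ip_scale_left ip_commute)

lemma ip_sum_right: "ip K z (\<lambda>k. \<Sum>j\<in>J. F j k) = (\<Sum>j\<in>J. ip K z (F j))"
  using ip_sum_left[of K F J z] by (simp add: ip_commute[of K z])

lemma ip_cong:
  "(\<And>k. k \<in> K \<Longrightarrow> x k = x' k) \<Longrightarrow> (\<And>k. k \<in> K \<Longrightarrow> y k = y' k) \<Longrightarrow> ip K x y = ip K x' y'"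
  unfolding ip_def by (rule sum.cong) auto

lemma ip_self_nonneg: "0 \<le> ip K x x"
  by (simp add: ip_def sum_nonneg)

lemma ip_self_eq_0: "finite K \<Longrightarrow> ip K x x = 0 \<longleftrightarrow> (\<forall>k\<in>K. x k = 0)"
  by (simp add: ip_def sum_nonneg_eq_0_iff)

lemma ip_delta: "finite K \<Longrightarrow> i \<in> K \<Longrightarrow> ip K x (\<lambda>k. of_bool (k = i)) = x i"
  by (simp add: ip_def of_bool_def if_distrib [of "(*) _"] sum.delta cong: if_cong)

section \<open>Projections and Bessel's inequality\<close>

lemma ip_combination:
  assumes "orthonormal_on J K u" "finite J"
  shows "ip K (\<lambda>k. \<Sum>j\<in>J. b j * u j k) (\<lambda>k. \<Sum>j\<in>J. c j * u j k) = (\<Sum>j\<in>J. b j * c j)"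
proof -
  have "ip K (u j) (\<lambda>k. \<Sum>j'\<in>J. c j' * u j' k) = c j" if "j \<in> J" for j
  proof -
    have "ip K (u j) (\<lambda>k. \<Sum>j'\<in>J. c j' * u j' k) = (\<Sum>j'\<in>J. c j' * of_bool (j = j'))"
      unfolding ip_sum_right ip_scale_right
      by (intro sum.cong refl) (use assms that in \<open>simp add: orthonormal_onD\<close>)
    also have "\<dots> = c j"
      using assms that by (simp add: of_bool_def if_distrib [of "(*) _"] cong: if_cong)
    finally show ?thesis .
  qed
  then show ?thesis
    by (simp add: ip_sum_left ip_scale_left)
qed

text \<open>Pythagoras: \<open>r\<close> is \<open>x\<close> minus its projection to the span of the
  family. That the left side is nonnegative is Bessel's inequality; where it vanishes, Parseval's
  identity holds.\<close>

lemma bessel_residual: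
  fixes x :: "'a \<Rightarrow> real"
  assumes "orthonormal_on J K u" "finite J"
  defines "r \<equiv> \<lambda>k. x k - (\<Sum>j\<in>J. ip K x (u j) * u j k)"
  shows "ip K r r = ip K x x - (\<Sum>j\<in>J. (ip K x (u j))\<^sup>2)"
proof -
  have "ip K (\<lambda>k. \<Sum>j\<in>J. ip K x (u j) * u j k) x = (\<Sum>j\<in>J. (ip K x (u j))\<^sup>2)"
    by (simp add: ip_sum_left ip_scale_left power2_eq_square) (simp add: ip_commute)
  moreover have "ip K x (\<lambda>k. \<Sum>j\<in>J. ip K x (u j) * u j k) = (\<Sum>j\<in>J. (ip K x (u j))\<^sup>2)"
    by (simp add: ip_sum_right ip_scale_right power2_eq_square)
  ultimately show ?thesis
    unfolding r_def ip_diff_left ip_diff_right ip_combination[OF assms(1,2)]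
    by (simp add: power2_eq_square)
qed

lemma bessel:
  assumes "orthonormal_on J K u" "finite J"
  shows "(\<Sum>j\<in>J. (ip K x (u j))\<^sup>2) \<le> ip K x x"
proof -
  have "0 \<le> ip K x x - (\<Sum>j\<in>J. (ip K x (u j))\<^sup>2)"
    unfolding bessel_residual[OF assms, symmetric] by (rule ip_self_nonneg)
  then show ?thesis by simp
qed

lemma residual_orthogonal:
  assumes "orthonormal_on J K u" "finite J" "j \<in> J"
  shows "ip K (\<lambda>k. x k - (\<Sum>j\<in>J. ip K x (u j) * u j k)) (u j) = 0"
proof -
  have "(\<Sum>j'\<in>J. ip K x (u j') * ip K (u j') (u j)) = (\<Sum>j'\<in>J. ip K x (u j') * of_bool (j' = j))"
    by (intro sum.cong refl) (use assms in \<open>simp add: orthonormal_onD\<close>)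
  also have "\<dots> = ip K x (u j)"
    using assms by (simp add: of_bool_def if_distrib [of "(*) _"] cong: if_cong)
  finally show ?thesis
    by (simp add: ip_diff_left ip_sum_left ip_scale_left)
qed

section \<open>Dimension counts, extension and completeness\<close>

text \<open>Summing Bessel's residual over the standard basis gives the difference of the cardinalities.\<close>

lemma sum_delta_residual:
  assumes "orthonormal_on J K u" "finite J" "finite K"
  shows "(\<Sum>i\<in>K. 1 - (\<Sum>j\<in>J. (u j i)\<^sup>2)) = real (card K) - real (card J)"
proof -
  have "(\<Sum>i\<in>K. \<Sum>j\<in>J. (u j i)\<^sup>2) = (\<Sum>j\<in>J. ip K (u j) (u j))"
    by (subst sum.swap) (simp add: ip_def power2_eq_square)
  also have "\<dots> = real (card J)"
    using assms by (simp add: orthonormal_onD)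
  finally show ?thesis
    by (simp add: sum_subtractf)
qed

text \<open>The residual of a standard basis vector, whose coefficient at \<open>u j\<close> is
  simply \<open>u j i\<close>.\<close>

lemma delta_residual:
  fixes i :: 'a
  assumes "orthonormal_on J K u" "finite J" "finite K" "i \<in> K"
  defines "r \<equiv> \<lambda>k. of_bool (k = i) - (\<Sum>j\<in>J. u j i * u j k)"
  shows "ip K r r = 1 - (\<Sum>j\<in>J. (u j i)\<^sup>2)" "\<And>j. j \<in> J \<Longrightarrow> ip K r (u j) = 0"
proof -
  have "ip K (\<lambda>k. of_bool (k = i)) y = y i" for y
    using ip_delta[OF assms(3,4)] by (metis ip_commute)
  then show "ip K r r = 1 - (\<Sum>j\<in>J. (u j i)\<^sup>2)" "\<And>j. j \<in> J \<Longrightarrow> ip K r (u j) = 0"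
    using bessel_residual[OF assms(1,2), of "\<lambda>k. of_bool (k = i)"]
      residual_orthogonal[OF assms(1,2), of _ "\<lambda>k. of_bool (k = i)"]
    by (simp_all add: r_def)
qed

lemma delta_residual_nonneg:
  assumes "orthonormal_on J K u" "finite J" "finite K" "i \<in> K"
  shows "0 \<le> 1 - (\<Sum>j\<in>J. (u j i)\<^sup>2)"
  by (subst delta_residual(1)[OF assms, symmetric]) (rule ip_self_nonneg)

text \<open>The total in \<open>sum_delta_residual\<close> is a sum of squared lengths, so the
  difference of the cardinalities cannot be negative.\<close>

lemma orthonormal_card_le:
  assumes "orthonormal_on J K u" "finite J" "finite K"
  shows "card J \<le> card K"
proof -
  have "0 \<le> (\<Sum>i\<in>K. 1 - (\<Sum>j\<in>J. (u j i)\<^sup>2))"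
    by (rule sum_nonneg) (rule delta_residual_nonneg[OF assms])
  then show ?thesis
    using sum_delta_residual[OF assms] by linarith
qed

text \<open>A positive total residual means that some standard basis vector lies outside the span;
  its residual, normalised, is the desired vector.\<close>

lemma ex_unit_orthogonal:
  assumes "orthonormal_on J K u" "finite J" "finite K" "card J < card K"
  obtains x where "ip K x x = 1" "\<And>j. j \<in> J \<Longrightarrow> ip K x (u j) = 0"
proof -
  have "\<exists>i\<in>K. 0 < 1 - (\<Sum>j\<in>J. (u j i)\<^sup>2)"
  proof (rule ccontr)
    assume "\<not> ?thesis"
    then have "(\<Sum>i\<in>K. 1 - (\<Sum>j\<in>J. (u j i)\<^sup>2)) \<le> 0"
      by (intro sum_nonpos) force
    then show False
      using sum_delta_residual[OF assms(1-3)] assms(4) by simp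
  qed
  then obtain i where i: "i \<in> K" "0 < 1 - (\<Sum>j\<in>J. (u j i)\<^sup>2)" by blast
  define r where "r = (\<lambda>k. of_bool (k = i) - (\<Sum>j\<in>J. u j i * u j k))"
  note r = delta_residual[OF assms(1-3) i(1), folded r_def]
  have "ip K (\<lambda>k. (1 / sqrt (ip K r r)) * r k) (\<lambda>k. (1 / sqrt (ip K r r)) * r k) = 1"
    unfolding ip_scale_left ip_scale_right using i r(1) by simp
  moreover have "ip K (\<lambda>k. (1 / sqrt (ip K r r)) * r k) (u j) = 0" if "j \<in> J" for j
    unfolding ip_scale_left using r(2) that by simp
  ultimately show thesis using that by blast
qed

lemma orthonormal_on_insert:
  assumes "orthonormal_on J K u" "ip K x x = 1" "\<And>j. j \<in> J \<Longrightarrow> ip K x (u j) = 0" "i \<notin> J"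
  shows "orthonormal_on (insert i J) K (u(i := x))"
proof -
  have "ip K (u j) x = 0" if "j \<in> J" for j
    using assms(3)[OF that] by (metis ip_commute)
  then show ?thesis
    using assms by (auto simp: orthonormal_on_def)
qed

text \<open>Basis extension, one index at a time by \<open>ex_unit_orthogonal\<close>. The members
  over \<open>J\<close> stay fixed, so that prescribed left singular vectors can be
  completed.\<close>

lemma orthonormal_extend:
  assumes "finite K" "finite J" "orthonormal_on J K u" "finite J'" "card (J \<union> J') \<le> card K"
  shows "\<exists>u'. orthonormal_on (J \<union> J') K u' \<and> (\<forall>j\<in>J. u' j = u j)"
  using assms(4,5)
proof (induction J')
  case empty
  then show ?case using assms by auto
next
  case (insert i J')
  then have "card (J \<union> J') \<le> card K"
    by (metis Un_insert_right card_insert_le order.trans)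
  then obtain u' where u': "orthonormal_on (J \<union> J') K u'" "\<forall>j\<in>J. u' j = u j"
    using insert by blast
  show ?case
  proof (cases "i \<in> J \<union> J'")
    case True
    then show ?thesis using u' by (auto simp: insert_absorb)
  next
    case False
    then have "card (J \<union> J') < card K"
      using insert assms by simp
    then obtain x where x: "ip K x x = 1" "\<And>j. j \<in> J \<union> J' \<Longrightarrow> ip K x (u' j) = 0"
      using ex_unit_orthogonal[OF u'(1)] insert assms by blast
    show ?thesis
      using orthonormal_on_insert[OF u'(1) x False] u'(2) False
      by (intro exI[of _ "u'(i := x)"]) (simp del: fun_upd_apply, auto)
  qed
qed

text \<open>The total residual is 0 and no summand is negative, so every standard basis vector
  equals its projection. In matrix terms, orthonormal columns of a square matrix give orthonormal
  rows.\<close>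

lemma orthonormal_complete:
  assumes "orthonormal_on J K u" "finite J" "finite K" "card J = card K" "i \<in> K" "k \<in> K"
  shows "(\<Sum>j\<in>J. u j i * u j k) = of_bool (i = k)"
proof -
  define r where "r = (\<lambda>k. of_bool (k = i) - (\<Sum>j\<in>J. u j i * u j k))"
  have "(\<Sum>i\<in>K. 1 - (\<Sum>j\<in>J. (u j i)\<^sup>2)) = 0"
    using sum_delta_residual[OF assms(1-3)] assms(4) by simp
  then have "1 - (\<Sum>j\<in>J. (u j i)\<^sup>2) = 0"
    using sum_nonneg_eq_0_iff[OF assms(3) delta_residual_nonneg[OF assms(1-3)]] assms(5) by simp
  then have "ip K r r = 0"
    using delta_residual(1)[OF assms(1-3,5)] by (simp add: r_def)
  then have "r k = 0"
    using assms(3,6) ip_self_eq_0 by blast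
  then show ?thesis by (auto simp: r_def)
qed

text \<open>Completeness makes every coordinate of the residual of \<open>x\<close> vanish, which
  turns Bessel's inequality into an equality.\<close>

lemma parseval:
  assumes "orthonormal_on J K u" "finite J" "finite K" "card J = card K"
  shows "(\<Sum>j\<in>J. (ip K x (u j))\<^sup>2) = ip K x x"
proof -
  define r where "r = (\<lambda>k. x k - (\<Sum>j\<in>J. ip K x (u j) * u j k))"
  have "r i = 0" if i: "i \<in> K" for i
  proof -
    have "(\<Sum>j\<in>J. ip K x (u j) * u j i) = ip K x (\<lambda>k. \<Sum>j\<in>J. u j i * u j k)"
      by (simp add: ip_sum_right ip_scale_right) (simp add: mult.commute)
    also have "\<dots> = ip K x (\<lambda>k. of_bool (k = i))"
      by (intro ip_cong refl) (auto simp: orthonormal_complete[OF assms i])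
    finally show ?thesis
      using assms(3) i by (simp add: r_def ip_delta)
  qed
  then have "ip K r r = 0"
    using assms(3) ip_self_eq_0 by blast
  then show ?thesis
    using bessel_residual[OF assms(1,2), of x] by (simp add: r_def)
qed

section \<open>Existence of a singular value decomposition\<close>

text \<open>The product of the matrix with rows \<open>a i\<close> and the vector
  \<open>v\<close>.\<close>

definition app :: "'k set \<Rightarrow> ('i \<Rightarrow> 'k \<Rightarrow> real) \<Rightarrow> ('k \<Rightarrow> real) \<Rightarrow> 'i \<Rightarrow> real" where
  "app K a v i = ip K (a i) v"

lemma app_add: "app K a (\<lambda>k. v k + w k) = (\<lambda>i. app K a v i + app K a w i)"
  and app_scale: "app K a (\<lambda>k. c * v k) = (\<lambda>i. c * app K a v i)"
  by (rule ext, simp only: app_def ip_add_right ip_scale_right)+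

text \<open>Values outside \<open>K\<close> are invisible to \<open>ip K\<close>; fixing them to 0
  keeps the set compact in the product topology.\<close>

lemma compact_unit_orthogonal:
  fixes K :: "'k set"
  assumes "finite K"
  shows "compact {v. (\<forall>k. k \<notin> K \<longrightarrow> v k = 0) \<and> ip K v v = 1 \<and> (\<forall>j\<in>J. ip K v (w j) = 0)}"
proof -
  \<comment> \<open>By Tychonoff, a cube over \<open>K\<close> and a single point elsewhere. Unit
    vectors lie in it since each squared coordinate is at most \<open>ip K v v\<close>.\<close>
  define B where "B = Pi UNIV (\<lambda>k. if k \<in> K then {-1..1} else {0 :: real})"
  have "compactin (product_topology (\<lambda>_. euclidean) UNIV) (PiE UNIV (\<lambda>k. if k \<in> K then {-1..1} else {0 :: real}))"
    by (subst compactin_PiE) auto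
  then have B: "compact B"
    by (simp add: B_def PiE_UNIV_domain euclidean_product_topology)
  have ci: "continuous_on UNIV (\<lambda>v. ip K v y)" "continuous_on UNIV (\<lambda>v. ip K v v)" for y
    unfolding ip_def by (intro continuous_intros continuous_on_product_coordinates)+
  have "closed ((\<Inter>k\<in>-K. {v. v k = 0}) \<inter> {v. ip K v v = 1} \<inter> (\<Inter>j\<in>J. {v. ip K v (w j) = 0}))"
    by (intro closed_Int closed_INT ballI closed_Collect_eq ci continuous_on_const
        continuous_on_product_coordinates)
  from compact_Int_closed[OF B this]
  have "compact (B \<inter> ((\<Inter>k\<in>-K. {v. v k = 0}) \<inter> {v. ip K v v = 1} \<inter> (\<Inter>j\<in>J. {v. ip K v (w j) = 0})))" .
  also have "B \<inter> ((\<Inter>k\<in>-K. {v. v k = 0}) \<inter> {v. ip K v v = 1} \<inter> (\<Inter>j\<in>J. {v. ip K v (w j) = 0})) =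
    {v. (\<forall>k. k \<notin> K \<longrightarrow> v k = 0) \<and> ip K v v = 1 \<and> (\<forall>j\<in>J. ip K v (w j) = 0)}"
  proof -
    have "v \<in> B" if "\<forall>k. k \<notin> K \<longrightarrow> v k = 0" "ip K v v = 1" for v
    proof -
      have "\<bar>v k\<bar> \<le> 1" if "k \<in> K" for k
      proof -
        have "v k * v k \<le> ip K v v"
          unfolding ip_def using assms that by (intro member_le_sum) auto
        then show ?thesis
          using \<open>ip K v v = 1\<close> abs_square_le_1[of "v k"] by (simp add: power2_eq_square)
      qed
      then show ?thesis using that by (auto simp: B_def abs_le_iff minus_le_iff)
    qed
    then show ?thesis by auto
  qed
  finally show ?thesis .
qed

text \<open>The maximum over unit vectors is stated in homogeneous form, so that it applies to a
  perturbed vector without normalising it first.\<close>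

lemma ex_max_stretch:
  fixes K :: "'k set" and a :: "'i \<Rightarrow> 'k \<Rightarrow> real"
  assumes "finite K" "finite J" "orthonormal_on J K w" "card J < card K"
  obtains v where "ip K v v = 1" "\<And>j. j \<in> J \<Longrightarrow> ip K v (w j) = 0"
    "\<And>x. (\<And>j. j \<in> J \<Longrightarrow> ip K x (w j) = 0) \<Longrightarrow>
       ip I (app K a x) (app K a x) \<le> ip I (app K a v) (app K a v) * ip K x x"
proof -
  define C where "C = {v. (\<forall>k. k \<notin> K \<longrightarrow> v k = 0) \<and> ip K v v = 1 \<and> (\<forall>j\<in>J. ip K v (w j) = 0)}"
  \<comment> \<open>Setting a vector to 0 outside \<open>K\<close> changes neither
    \<open>ip K\<close> nor \<open>app K a\<close> and meets the support condition of
    \<open>C\<close>.\<close>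
  define cut where "cut x = (\<lambda>k. if k \<in> K then x k else (0::real))" for x
  have cut: "ip K (cut x) y = ip K x y" "ip K y (cut x) = ip K y x" for x y
    by (auto intro: ip_cong simp: cut_def)
  have cutapp: "app K a (cut x) = app K a x" for x
    by (simp add: app_def cut fun_eq_iff)
  obtain x0 where x0: "ip K x0 x0 = 1" "\<And>j. j \<in> J \<Longrightarrow> ip K x0 (w j) = 0"
    using ex_unit_orthogonal[OF assms(3,2,1,4)] by blast
  then have "cut x0 \<in> C" by (simp add: C_def cut) (simp add: cut_def)
  moreover have "compact C"
    unfolding C_def using assms(1) by (rule compact_unit_orthogonal)
  moreover have "continuous_on C (\<lambda>v. ip I (app K a v) (app K a v))"
    unfolding ip_def app_def
    by (intro continuous_intros continuous_on_subset[OF continuous_on_product_coordinates]) auto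
  ultimately obtain v where v: "v \<in> C"
    "\<And>x. x \<in> C \<Longrightarrow> ip I (app K a x) (app K a x) \<le> ip I (app K a v) (app K a v)"
    using continuous_attains_sup[of C "\<lambda>v. ip I (app K a v) (app K a v)"] by blast
  show thesis
  proof (rule that)
    show "ip K v v = 1" "\<And>j. j \<in> J \<Longrightarrow> ip K v (w j) = 0"
      using v(1) by (auto simp: C_def)
    fix x assume x: "\<And>j. j \<in> J \<Longrightarrow> ip K x (w j) = 0"
    show "ip I (app K a x) (app K a x) \<le> ip I (app K a v) (app K a v) * ip K x x"
    proof (cases "ip K x x = 0")
      case True
      then have "app K a x = (\<lambda>_. 0)"
        using assms(1) by (simp add: ip_self_eq_0 app_def fun_eq_iff) (simp add: ip_def)
      then show ?thesis using True by (simp add: ip_def)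
    next
      case False
      then have pos: "0 < ip K x x" using ip_self_nonneg[of K x] by linarith
      define c where "c = 1 / sqrt (ip K x x)"
      have c: "c * (c * t) = t / ip K x x" for t
        using pos by (simp add: c_def field_simps)
      have "cut (\<lambda>k. c * x k) \<in> C"
        using pos x by (simp add: C_def cut ip_scale_left ip_scale_right c) (simp add: cut_def)
      from v(2)[OF this] show ?thesis
        using pos by (simp add: cutapp app_scale ip_scale_left ip_scale_right c divide_le_eq)
    qed
  qed
qed

text \<open>Near \<open>t = 0\<close> the linear term outweighs the quadratic one unless
  \<open>b = 0\<close>.\<close>

lemma linear_le_square_imp_0:
  fixes b c :: real
  assumes "\<And>t. 2 * t * b \<le> t\<^sup>2 * c"
  shows "b = 0"
proof (rule ccontr)
  assume "b \<noteq> 0"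
  \<comment> \<open>\<open>e\<close> is positive and exceeds \<open>c\<close>; the choice
    \<open>t = b / e\<close> turns the inequality into \<open>2 * e \<le> c\<close>.\<close>
  define e where "e = \<bar>c\<bar> + 1"
  have "2 * (b / e) * b \<le> (b / e)\<^sup>2 * c" by (rule assms)
  moreover have "e > 0" by (simp add: e_def)
  ultimately have "2 * b\<^sup>2 * e \<le> b\<^sup>2 * c"
    by (simp add: field_simps power2_eq_square)
  then have "2 * e \<le> c" using \<open>b \<noteq> 0\<close> by (simp add: mult.assoc mult.left_commute[of 2])
  then show False by (simp add: e_def)
qed

text \<open>The vectors are picked greedily: a unit vector \<open>v\<close> that maximises the stretch \<open>|a v|\<close> on the
  orthogonal complement of its predecessors satisfies \<open>a v \<bottom> a x\<close> for all \<open>x \<bottom> v\<close> in that complement.\<close>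

lemma ex_orthonormal_with_orthogonal_images:
  fixes K :: "'k set" and a :: "'i \<Rightarrow> 'k \<Rightarrow> real"
  assumes "finite K" "finite J" "card J \<le> card K"
  shows "\<exists>v. orthonormal_on J K v \<and>
    (\<forall>i\<in>J. \<forall>j\<in>J. i \<noteq> j \<longrightarrow> ip I (app K a (v i)) (app K a (v j)) = 0) \<and>
    (\<forall>x. (\<forall>j\<in>J. ip K x (v j) = 0) \<longrightarrow> (\<forall>j\<in>J. ip I (app K a x) (app K a (v j)) = 0))"
  using assms(2,3)
proof (induction J)
  case empty
  show ?case by (simp add: orthonormal_on_def)
next
  \<comment> \<open>The third conjunct, \<open>co\<close>, carries the induction: it makes the image
    of the next vector orthogonal to all earlier images.\<close>
  case (insert i J)
  then obtain v where on: "orthonormal_on J K v"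
    and im: "\<And>i j. i \<in> J \<Longrightarrow> j \<in> J \<Longrightarrow> i \<noteq> j \<Longrightarrow> ip I (app K a (v i)) (app K a (v j)) = 0"
    and co: "\<And>x j. (\<forall>j\<in>J. ip K x (v j) = 0) \<Longrightarrow> j \<in> J \<Longrightarrow> ip I (app K a x) (app K a (v j)) = 0"
    by (auto simp: card_insert_if)
  obtain x where x: "ip K x x = 1" "\<And>j. j \<in> J \<Longrightarrow> ip K x (v j) = 0"
    and max: "\<And>y. (\<And>j. j \<in> J \<Longrightarrow> ip K y (v j) = 0) \<Longrightarrow>
       ip I (app K a y) (app K a y) \<le> ip I (app K a x) (app K a x) * ip K y y"
    using ex_max_stretch[OF assms(1) insert(1) on, of I a] insert by auto
  \<comment> \<open>Compare \<open>x\<close> with \<open>x + t y\<close>: the squared length grows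
    only by a multiple of \<open>t\<^sup>2\<close>, while the squared length of the image has the
    linear term \<open>2 * t * ip I (app K a y) (app K a x)\<close>. Maximality for all
    \<open>t\<close> forces that term to vanish.\<close>
  have orth: "ip I (app K a y) (app K a x) = 0"
    if y: "\<And>j. j \<in> J \<Longrightarrow> ip K y (v j) = 0" "ip K y x = 0" for y
  proof (rule linear_le_square_imp_0)
    fix t
    have "ip K (\<lambda>k. x k + t * y k) (v j) = 0" if "j \<in> J" for j
      using x y that by (simp add: ip_add_left ip_scale_left)
    from max[OF this]
    show "2 * t * ip I (app K a y) (app K a x) \<le>
        t\<^sup>2 * (ip I (app K a x) (app K a x) * ip K y y - ip I (app K a y) (app K a y))"
      using x(1) y(2)
      by (simp add: app_add app_scale ip_add_left ip_add_right ip_scale_left ip_scale_right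
          ip_commute[of K x y] ip_commute[of I "app K a x" "app K a y"] power2_eq_square algebra_simps)
  qed
  let ?v = "v(i := x)"
  show ?case
  proof (intro exI[of _ ?v] conjI ballI allI impI)
    show "orthonormal_on (insert i J) K ?v"
      using orthonormal_on_insert[OF on x insert(2)] .
  next
    fix j j' assume "j \<in> insert i J" "j' \<in> insert i J" "j \<noteq> j'"
    then show "ip I (app K a (?v j)) (app K a (?v j')) = 0"
      using insert(2) im co[of x j] co[of x j'] x(2) ip_commute[of I "app K a (v j)" "app K a x"]
      by (cases "j = i"; cases "j' = i") simp_all
  next
    fix y j assume "\<forall>j\<in>insert i J. ip K y (?v j) = 0" and j: "j \<in> insert i J"
    then have "ip K y x = 0" "\<And>j. j \<in> J \<Longrightarrow> ip K y (v j) = 0"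
      using insert(2) by (auto split: if_splits)
    with orth[of y] co[of y j] j show "ip I (app K a y) (app K a (?v j)) = 0"
      by (cases "j = i") simp_all
  qed
qed

lemma ex_svd:
  fixes I :: "'i set" and K :: "'k set" and a :: "'i \<Rightarrow> 'k \<Rightarrow> real"
  assumes "finite I" "finite K"
  obtains u v s where "orthonormal_on I I u" "orthonormal_on K K v"
    "\<And>i k. 0 \<le> s i k"
    "\<And>i k k'. s i k \<noteq> 0 \<Longrightarrow> s i k' \<noteq> 0 \<Longrightarrow> k = k'"
    "\<And>i i' k. s i k \<noteq> 0 \<Longrightarrow> s i' k \<noteq> 0 \<Longrightarrow> i = i'"
    "\<And>i k. i \<in> I \<Longrightarrow> k \<in> K \<Longrightarrow> a i k = (\<Sum>l\<in>K. (\<Sum>j\<in>I. u j i * s j l) * v l k)"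
proof -
  obtain v where v: "orthonormal_on K K v"
    and im: "\<And>i j. i \<in> K \<Longrightarrow> j \<in> K \<Longrightarrow> i \<noteq> j \<Longrightarrow> ip I (app K a (v i)) (app K a (v j)) = 0"
    using ex_orthonormal_with_orthogonal_images[OF assms(2,2), of I a] by auto
  \<comment> \<open>The singular values, indexed like the right singular vectors. \<open>J\<close>
    collects the nonzero ones, where the image of \<open>v k\<close> can be normalised to a left
    singular vector.\<close>
  define t where "t k = sqrt (ip I (app K a (v k)) (app K a (v k)))" for k
  define J where "J = {k \<in> K. t k \<noteq> 0}"
  define u0 where "u0 k = (\<lambda>i. (1 / t k) * app K a (v k) i)" for k
  have t2: "t k * t k = ip I (app K a (v k)) (app K a (v k))" for k
    by (simp add: t_def ip_self_nonneg)
  have finJ: "finite J" using assms by (simp add: J_def)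
  have u0: "orthonormal_on J I u0"
    unfolding orthonormal_on_def u0_def ip_scale_left ip_scale_right
    using im by (auto simp: J_def) (simp add: t2[symmetric])
  have "card J \<le> card I"
    using orthonormal_card_le[OF u0 finJ assms(1)] .
  \<comment> \<open>The left vectors found so far are indexed by \<open>J \<subseteq> K\<close>, but
    the left basis is indexed by \<open>I\<close>; \<open>f\<close> relabels them.\<close>
  then obtain f where f: "inj_on f J" "f ` J \<subseteq> I"
    using finJ assms(1) by (meson card_le_inj)
  have "orthonormal_on (f ` J) I (\<lambda>i. u0 (the_inv_into J f i))"
    using u0 f(1) by (auto simp: orthonormal_on_def the_inv_into_f_f inj_on_eq_iff)
  moreover have "f ` J \<union> I = I" using f by blast
  ultimately obtain u where u: "orthonormal_on I I u"
    and uf: "\<And>i. i \<in> f ` J \<Longrightarrow> u i = u0 (the_inv_into J f i)"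
    using orthonormal_extend[of I "f ` J" "\<lambda>i. u0 (the_inv_into J f i)" I] assms(1) finJ by auto
  have ufk: "u (f k) = u0 k" if "k \<in> J" for k
    using uf[of "f k"] that f(1) by (simp add: the_inv_into_f_f)
  \<comment> \<open>A nonzero entry of column \<open>k\<close> can only stand in row
    \<open>f k\<close>; injectivity of \<open>f\<close> on \<open>J\<close> gives at most one
    nonzero entry per row.\<close>
  define s where "s i k = (if k \<in> J \<and> i = f k then t k else 0)" for i k
  show thesis
  proof (rule that[OF u v])
    show "0 \<le> s i k" for i k
      by (simp add: s_def t_def ip_self_nonneg)
    show "k = k'" if "s i k \<noteq> 0" "s i k' \<noteq> 0" for i k k'
      using that f(1) by (auto simp: s_def inj_on_eq_iff split: if_splits)
    show "i = i'" if "s i k \<noteq> 0" "s i' k \<noteq> 0" for i i' k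
      using that by (auto simp: s_def split: if_splits)
  next
    fix i k assume ik: "i \<in> I" "k \<in> K"
    \<comment> \<open>Column \<open>l\<close> of the product of \<open>u\<close> and
      \<open>s\<close> is the image of \<open>v l\<close>. For \<open>l\<close> outside
      \<open>J\<close> that image is 0, matching the zero column of \<open>s\<close>.\<close>
    have col: "(\<Sum>j\<in>I. u j i * s j l) = app K a (v l) i" if "l \<in> K" for l
    proof (cases "l \<in> J")
      case True
      then have "(\<Sum>j\<in>I. u j i * s j l) = (\<Sum>j\<in>I. if j = f l then u (f l) i * t l else 0)"
        by (intro sum.cong) (auto simp: s_def)
      also have "\<dots> = u (f l) i * t l"
        using True f assms by auto
      also have "\<dots> = app K a (v l) i"
        using True by (simp add: ufk u0_def J_def)
      finally show ?thesis .
    next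
      case False
      then have "ip I (app K a (v l)) (app K a (v l)) = 0"
        using that by (simp add: J_def t_def)
      then have "app K a (v l) i = 0" using assms(1) ik ip_self_eq_0 by blast
      then show ?thesis using False by (simp add: s_def)
    qed
    \<comment> \<open>This expands the row \<open>a i\<close> in the complete family
      \<open>v\<close>.\<close>
    have "(\<Sum>l\<in>K. (\<Sum>j\<in>I. u j i * s j l) * v l k) = (\<Sum>l\<in>K. ip K (a i) (v l) * v l k)"
      by (intro sum.cong refl) (simp add: col app_def)
    also have "\<dots> = ip K (a i) (\<lambda>c. \<Sum>l\<in>K. v l k * v l c)"
      by (simp add: ip_sum_right ip_scale_right) (simp add: mult.commute)
    also have "\<dots> = ip K (a i) (\<lambda>c. of_bool (c = k))"
      by (intro ip_cong refl) (auto simp: orthonormal_complete[OF v assms(2,2) refl ik(2)])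
    also have "\<dots> = a i k"
      using assms(2) ik by (simp add: ip_delta)
    finally show "a i k = (\<Sum>l\<in>K. (\<Sum>j\<in>I. u j i * s j l) * v l k)" by simp
  qed
qed

section \<open>Tensors as matrices indexed by multi-indices\<close>

lemma multi_indices_Nil: "multi_indices [] = {[]}"
  by (auto simp: multi_indices_def)

lemma multi_indices_Cons: "multi_indices (d # ds) = (\<lambda>(i, is). i # is) ` ({..<d} \<times> multi_indices ds)"
  by (auto simp: multi_indices_def list_all2_Cons2 image_iff)

lemma multi_indices_single: "multi_indices [n] = (\<lambda>i. [i]) ` {..<n}"
  by (auto simp: multi_indices_Cons multi_indices_Nil)

lemma finite_multi_indices [simp]: "finite (multi_indices ds)"
  by (induction ds) (simp_all add: multi_indices_Nil multi_indices_Cons)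

lemma card_multi_indices: "card (multi_indices ds) = prod_list ds"
proof (induction ds)
  case (Cons d ds)
  have "inj_on (\<lambda>(i, is). i # is) ({..<d} \<times> multi_indices ds)"
    by (auto simp: inj_on_def)
  then show ?case
    using Cons by (simp add: multi_indices_Cons card_image card_cartesian_product)
qed (simp add: multi_indices_Nil)

lemma sum_multi_indices_single: "(\<Sum>ks\<in>multi_indices [n]. f ks) = (\<Sum>i<n. f [i])"
  unfolding multi_indices_single by (subst sum.reindex) (auto simp: inj_on_def)

lemma multi_indices_appendE:
  assumes "is \<in> multi_indices (ds @ es)"
  obtains a b where "a \<in> multi_indices ds" "b \<in> multi_indices es" "is = a @ b"
  using assms by (auto simp: multi_indices_def list_all2_append2)

lemma tensor_append_eqI:
  assumes "A \<in> carrier_tensor (Is @ Js)" "B \<in> carrier_tensor (Is @ Js)"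
    and "\<And>i j. i \<in> multi_indices Is \<Longrightarrow> j \<in> multi_indices Js \<Longrightarrow> entry A (i @ j) = entry B (i @ j)"
  shows "A = B"
proof (rule tensor_eqI)
  show "dims A = dims B" using assms by (simp add: carrier_tensor_def)
  fix x assume "x \<in> multi_indices (dims A)"
  then have "x \<in> multi_indices (Is @ Js)" using assms by (simp add: carrier_tensor_def)
  then show "entry A x = entry B x" by (rule multi_indices_appendE) (use assms in simp)
qed

lemma einstein_product_carrier:
  "A \<in> carrier_tensor (Is @ Ks) \<Longrightarrow> B \<in> carrier_tensor (Ks @ Js) \<Longrightarrow>
    einstein_product (length Ks) A B \<in> carrier_tensor (Is @ Js)"
  by (simp add: einstein_product_def carrier_tensor_def Let_def)

lemma transpose_tensor_carrier:
  "A \<in> carrier_tensor (Is @ Js) \<Longrightarrow> transpose_tensor (length Is) A \<in> carrier_tensor (Js @ Is)"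
  by (simp add: transpose_tensor_def carrier_tensor_def)

lemma id_tensor_carrier: "id_tensor ds \<in> carrier_tensor (ds @ ds)"
  by (simp add: id_tensor_def carrier_tensor_def)

lemma entry_id_tensor:
  "i \<in> multi_indices ds \<Longrightarrow> j \<in> multi_indices ds \<Longrightarrow> entry (id_tensor ds) (i @ j) = of_bool (i = j)"
  by (simp add: id_tensor_def entry_tensor multi_indices_append length_multi_indices)

definition tensor_of_fun2 :: "nat list \<Rightarrow> nat list \<Rightarrow> (nat list \<Rightarrow> nat list \<Rightarrow> real) \<Rightarrow> tensor" where
  "tensor_of_fun2 Is Js f = tensor (Is @ Js) (\<lambda>x. f (take (length Is) x) (drop (length Is) x))"

lemma tensor_of_fun2_carrier: "tensor_of_fun2 Is Js f \<in> carrier_tensor (Is @ Js)"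
  by (simp add: tensor_of_fun2_def carrier_tensor_def)

lemma entry_tensor_of_fun2:
  "i \<in> multi_indices Is \<Longrightarrow> j \<in> multi_indices Js \<Longrightarrow> entry (tensor_of_fun2 Is Js f) (i @ j) = f i j"
  by (simp add: tensor_of_fun2_def entry_tensor multi_indices_append length_multi_indices)

text \<open>The trailing index comes first, so that \<open>column A\<close> is a family in the form
  that \<open>orthonormal_on\<close> expects.\<close>

definition column :: "tensor \<Rightarrow> nat list \<Rightarrow> nat list \<Rightarrow> real" where
  "column A k i = entry A (i @ k)"

text \<open>The entries of the product are the inner products of the columns of \<open>P\<close>.
  Serves both feasibility (\<open>Js = [d]\<close>) and unitarity (\<open>Js = Is\<close>).\<close>

lemma transpose_product_eq_id_iff:
  assumes "P \<in> carrier_tensor (Is @ Js)"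
  shows "einstein_product (length Is) (transpose_tensor (length Is) P) P = id_tensor Js \<longleftrightarrow>
    orthonormal_on (multi_indices Js) (multi_indices Is) (column P)" (is "?L = _ \<longleftrightarrow> _")
proof -
  note T = transpose_tensor_carrier[OF assms]
  have e: "entry ?L (j @ j') = ip (multi_indices Is) (column P j) (column P j')"
    if "j \<in> multi_indices Js" "j' \<in> multi_indices Js" for j j'
    unfolding entry_einstein_product[OF T assms that] ip_def column_def
    by (intro sum.cong refl) (simp add: entry_transpose_tensor[OF assms] that)
  show ?thesis
  proof
    assume "?L = id_tensor Js"
    then show "orthonormal_on (multi_indices Js) (multi_indices Is) (column P)"
      by (auto simp: orthonormal_on_def e[symmetric] entry_id_tensor)
  next
    assume "orthonormal_on (multi_indices Js) (multi_indices Is) (column P)"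
    note on = orthonormal_onD[OF this]
    show "?L = id_tensor Js"
    proof (rule tensor_append_eqI[OF einstein_product_carrier[OF T assms] id_tensor_carrier])
      fix j j' assume "j \<in> multi_indices Js" "j' \<in> multi_indices Js"
      then show "entry ?L (j @ j') = entry (id_tensor Js) (j @ j')"
        by (simp only: e on entry_id_tensor)
    qed
  qed
qed

text \<open>As many columns as coordinates: \<open>orthonormal_complete\<close> turns orthonormal
  columns into orthonormal rows.\<close>

lemma unitary_tensor_iff:
  "unitary_tensor ds U \<longleftrightarrow> U \<in> carrier_tensor (ds @ ds) \<and>
     orthonormal_on (multi_indices ds) (multi_indices ds) (column U)"
proof -
  have "einstein_product (length ds) U (transpose_tensor (length ds) U) = id_tensor ds"
    if U: "U \<in> carrier_tensor (ds @ ds)"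
      and on: "orthonormal_on (multi_indices ds) (multi_indices ds) (column U)"
  proof (rule tensor_append_eqI[OF _ id_tensor_carrier])
    note T = transpose_tensor_carrier[OF U]
    show "einstein_product (length ds) U (transpose_tensor (length ds) U) \<in> carrier_tensor (ds @ ds)"
      by (rule einstein_product_carrier[OF U T])
    fix i j assume ij: "i \<in> multi_indices ds" "j \<in> multi_indices ds"
    have "entry (einstein_product (length ds) U (transpose_tensor (length ds) U)) (i @ j) =
      (\<Sum>k\<in>multi_indices ds. column U k i * column U k j)"
      unfolding entry_einstein_product[OF U T ij] column_def
      by (intro sum.cong refl) (simp add: entry_transpose_tensor[OF U] ij)
    also have "\<dots> = of_bool (i = j)"
      by (rule orthonormal_complete[OF on _ _ refl ij]) simp_all
    finally show "entry (einstein_product (length ds) U (transpose_tensor (length ds) U)) (i @ j) =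
        entry (id_tensor ds) (i @ j)"
      by (simp add: entry_id_tensor ij)
  qed
  then show ?thesis
    unfolding unitary_tensor_def using transpose_product_eq_id_iff by blast
qed

section \<open>The E-SVD in coordinates\<close>

lemma esvd_product_carrier:
  assumes "U \<in> carrier_tensor (Is @ Is)" "S \<in> carrier_tensor (Is @ Ks)" "V \<in> carrier_tensor (Ks @ Ks)"
  shows "einstein_product (length Ks) (einstein_product (length Is) U S)
      (transpose_tensor (length Ks) V) \<in> carrier_tensor (Is @ Ks)"
  by (intro einstein_product_carrier[OF einstein_product_carrier] transpose_tensor_carrier assms)

lemma entry_esvd_product:
  assumes "U \<in> carrier_tensor (Is @ Is)" "S \<in> carrier_tensor (Is @ Ks)" "V \<in> carrier_tensor (Ks @ Ks)"
    and i: "i \<in> multi_indices Is" and k: "k \<in> multi_indices Ks"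
  shows "entry (einstein_product (length Ks) (einstein_product (length Is) U S)
      (transpose_tensor (length Ks) V)) (i @ k) =
    (\<Sum>l\<in>multi_indices Ks. (\<Sum>j\<in>multi_indices Is. column U j i * entry S (j @ l)) * column V l k)"
  unfolding entry_einstein_product[OF einstein_product_carrier[OF assms(1,2)]
      transpose_tensor_carrier[OF assms(3)] i k]
  by (intro sum.cong refl)
    (simp add: entry_einstein_product[OF assms(1,2) i] entry_transpose_tensor[OF assms(3) k] column_def)

lemma ex_esvd:
  assumes "A \<in> carrier_tensor (Is @ Ks)"
  shows "\<exists>U S V. is_esvd Is Ks A U S V"
proof -
  obtain u v s where u: "orthonormal_on (multi_indices Is) (multi_indices Is) u"
    and v: "orthonormal_on (multi_indices Ks) (multi_indices Ks) v"
    and s: "\<And>i k. 0 \<le> s i k"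
      "\<And>i k k'. s i k \<noteq> 0 \<Longrightarrow> s i k' \<noteq> 0 \<Longrightarrow> k = k'"
      "\<And>i i' k. s i k \<noteq> 0 \<Longrightarrow> s i' k \<noteq> 0 \<Longrightarrow> i = i'"
    and a: "\<And>i k. i \<in> multi_indices Is \<Longrightarrow> k \<in> multi_indices Ks \<Longrightarrow> entry A (i @ k) =
      (\<Sum>l\<in>multi_indices Ks. (\<Sum>j\<in>multi_indices Is. u j i * s j l) * v l k)"
    using ex_svd[OF finite_multi_indices[of Is] finite_multi_indices[of Ks], of "\<lambda>i k. entry A (i @ k)"]
    by blast
  \<comment> \<open>The family index becomes the trailing index, so that \<open>column U j\<close>
    agrees with \<open>u j\<close>.\<close>
  define U where "U = tensor_of_fun2 Is Is (\<lambda>i j. u j i)"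
  define V where "V = tensor_of_fun2 Ks Ks (\<lambda>i j. v j i)"
  define S where "S = tensor_of_fun2 Is Ks s"
  have c: "U \<in> carrier_tensor (Is @ Is)" "S \<in> carrier_tensor (Is @ Ks)" "V \<in> carrier_tensor (Ks @ Ks)"
    by (simp_all add: U_def V_def S_def tensor_of_fun2_carrier)
  have U: "column U j i = u j i" if "i \<in> multi_indices Is" "j \<in> multi_indices Is" for i j
    using that by (simp add: U_def column_def entry_tensor_of_fun2)
  have V: "column V j i = v j i" if "i \<in> multi_indices Ks" "j \<in> multi_indices Ks" for i j
    using that by (simp add: V_def column_def entry_tensor_of_fun2)
  have S: "entry S (i @ k) = s i k" if "i \<in> multi_indices Is" "k \<in> multi_indices Ks" for i k
    using that by (simp add: S_def entry_tensor_of_fun2)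
  have "unitary_tensor Is U"
    using u by (simp add: unitary_tensor_iff c orthonormal_on_def ip_def U)
  moreover have "unitary_tensor Ks V"
    using v by (simp add: unitary_tensor_iff c orthonormal_on_def ip_def V)
  moreover have "diagonal_like Is Ks S"
    unfolding diagonal_like_def using s(2,3) by (auto simp: S)
  moreover have "0 \<le> entry S x" if "x \<in> multi_indices (Is @ Ks)" for x
    using that by (rule multi_indices_appendE) (simp add: S s(1))
  moreover have "A = einstein_product (length Ks) (einstein_product (length Is) U S)
      (transpose_tensor (length Ks) V)"
  proof (rule tensor_append_eqI[OF assms esvd_product_carrier[OF c]])
    fix i k assume ik: "i \<in> multi_indices Is" "k \<in> multi_indices Ks"
    show "entry A (i @ k) = entry (einstein_product (length Ks) (einstein_product (length Is) U S)
        (transpose_tensor (length Ks) V)) (i @ k)"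
      unfolding a[OF ik] entry_esvd_product[OF c ik]
      by (intro sum.cong refl arg_cong2[of _ _ _ _ "(*)"]) (simp_all only: ik U V S)
  qed
  ultimately have "is_esvd Is Ks A U S V"
    unfolding is_esvd_def using assms c(2) by blast
  then show ?thesis by blast
qed

text \<open>All cross terms vanish. Meant for the columns of a diagonal-like tensor.\<close>

lemma square_sum_at_most_one:
  fixes f :: "'a \<Rightarrow> real"
  assumes "finite A" "\<And>i j. i \<in> A \<Longrightarrow> j \<in> A \<Longrightarrow> f i \<noteq> 0 \<Longrightarrow> f j \<noteq> 0 \<Longrightarrow> i = j"
  shows "(\<Sum>i\<in>A. f i)\<^sup>2 = (\<Sum>i\<in>A. (f i)\<^sup>2)"
proof (cases "\<exists>i\<in>A. f i \<noteq> 0")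
  case True
  then obtain i where i: "i \<in> A" "f i \<noteq> 0" by blast
  have "sum g A = g i" if "\<And>j. f j = 0 \<Longrightarrow> g j = 0" for g :: "'a \<Rightarrow> real"
  proof -
    have "sum g A = sum g {i}"
      using assms i that by (intro sum.mono_neutral_right) auto
    then show ?thesis by simp
  qed
  from this[of f] this[of "\<lambda>j. (f j)\<^sup>2"] show ?thesis by simp
qed simp

lemma singular_value_eq_entry:
  assumes "diagonal_like Is Ks S" "i \<in> multi_indices Is" "k \<in> multi_indices Ks" "entry S (i @ k) \<noteq> 0"
  shows "singular_value Ks S i = entry S (i @ k)"
proof -
  have "(THE k. k \<in> multi_indices Ks \<and> entry S (i @ k) \<noteq> 0) = k"
    using assms unfolding diagonal_like_def by (intro the_equality) blast+
  then show ?thesis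
    unfolding singular_value_def using assms(3,4) by (metis (no_types, lifting))
qed

text \<open>A sum over the whole row removes the description operator and covers the default value 0
  as well.\<close>

lemma singular_value_square:
  assumes "diagonal_like Is Ks S" "i \<in> multi_indices Is"
  shows "(singular_value Ks S i)\<^sup>2 = (\<Sum>k\<in>multi_indices Ks. (entry S (i @ k))\<^sup>2)"
proof (cases "\<exists>k\<in>multi_indices Ks. entry S (i @ k) \<noteq> 0")
  case True
  then obtain k where k: "k \<in> multi_indices Ks" "entry S (i @ k) \<noteq> 0" by blast
  have "entry S (i @ k') = 0" if "k' \<in> multi_indices Ks - {k}" for k'
    using assms k that unfolding diagonal_like_def by blast
  then have "(\<Sum>k\<in>multi_indices Ks. (entry S (i @ k))\<^sup>2) = (\<Sum>k\<in>{k}. (entry S (i @ k))\<^sup>2)"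
    using k by (intro sum.mono_neutral_right) simp_all
  then show ?thesis
    by (simp add: singular_value_eq_entry[OF assms k])
next
  case False
  then show ?thesis by (simp add: singular_value_def)
qed

lemma singular_value_nonneg:
  assumes "is_esvd Is Ks A U S V" "i \<in> multi_indices Is"
  shows "0 \<le> singular_value Ks S i"
proof (cases "\<exists>k\<in>multi_indices Ks. entry S (i @ k) \<noteq> 0")
  case True
  then obtain k where k: "k \<in> multi_indices Ks" "entry S (i @ k) \<noteq> 0" by blast
  have "singular_value Ks S i = entry S (i @ k)"
    using assms k by (intro singular_value_eq_entry) (simp_all add: is_esvd_def)
  then show ?thesis
    using assms multi_indices_append[OF assms(2) k(1)] by (simp add: is_esvd_def)
qed (simp add: singular_value_def)

text \<open>In matrix terms, the squared length of \<open>A^T q = V S^T U^T q\<close>: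
  \<open>V\<close> preserves lengths, and the diagonal shape of \<open>S\<close> leaves one weighted
  square for each left singular tensor.\<close>

lemma esvd_quadratic_form:
  assumes "is_esvd Is Ks A U S V"
  shows "(\<Sum>k\<in>multi_indices Ks. (ip (multi_indices Is) q (column A k))\<^sup>2) =
    (\<Sum>j\<in>multi_indices Is. (singular_value Ks S j)\<^sup>2 * (ip (multi_indices Is) q (column U j))\<^sup>2)"
proof -
  let ?I = "multi_indices Is" and ?K = "multi_indices Ks"
  have c: "U \<in> carrier_tensor (Is @ Is)" "S \<in> carrier_tensor (Is @ Ks)" "V \<in> carrier_tensor (Ks @ Ks)"
    and V: "orthonormal_on ?K ?K (column V)" and diag: "diagonal_like Is Ks S"
    and A: "A = einstein_product (length Ks) (einstein_product (length Is) U S)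
      (transpose_tensor (length Ks) V)"
    using assms by (auto simp: is_esvd_def unitary_tensor_iff)
  \<comment> \<open>\<open>b\<close> holds the coordinates of \<open>U^T q\<close>, and
    \<open>e\<close> those of \<open>S^T U^T q\<close>.\<close>
  define b where "b j = ip ?I q (column U j)" for j
  define e where "e l = (\<Sum>j\<in>?I. entry S (j @ l) * b j)" for l
  have col: "ip ?I q (column A k) = (\<Sum>l\<in>?K. e l * column V l k)" if k: "k \<in> ?K" for k
  proof -
    have "ip ?I q (column A k) =
      ip ?I q (\<lambda>i. \<Sum>l\<in>?K. column V l k * (\<Sum>j\<in>?I. entry S (j @ l) * column U j i))"
      by (intro ip_cong refl) (simp add: A column_def[of "einstein_product _ _ _"]
          entry_esvd_product[OF c _ k] mult.commute)
    then show ?thesis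
      unfolding ip_sum_right ip_scale_right e_def b_def by (simp add: mult.commute)
  qed
  have "(\<Sum>k\<in>?K. (ip ?I q (column A k))\<^sup>2) =
      ip ?K (\<lambda>k. \<Sum>l\<in>?K. e l * column V l k) (\<lambda>k. \<Sum>l\<in>?K. e l * column V l k)"
    unfolding ip_def[of ?K] by (intro sum.cong refl) (simp add: col power2_eq_square)
  also have "\<dots> = (\<Sum>l\<in>?K. (e l)\<^sup>2)"
    by (simp add: ip_combination[OF V] power2_eq_square)
  \<comment> \<open>Each column of \<open>S\<close> has at most one nonzero entry, so the square
    moves inside the sum over \<open>j\<close>. The same property of the rows enters through
    \<open>singular_value_square\<close>.\<close>
  also have "\<dots> = (\<Sum>l\<in>?K. \<Sum>j\<in>?I. (entry S (j @ l) * b j)\<^sup>2)"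
    unfolding e_def
    by (intro sum.cong refl square_sum_at_most_one) (use diag in \<open>auto simp: diagonal_like_def\<close>)
  also have "\<dots> = (\<Sum>j\<in>?I. (\<Sum>l\<in>?K. (entry S (j @ l))\<^sup>2) * (b j)\<^sup>2)"
    by (subst sum.swap) (simp add: power_mult_distrib sum_distrib_right)
  also have "\<dots> = (\<Sum>j\<in>?I. (singular_value Ks S j)\<^sup>2 * (b j)\<^sup>2)"
    by (intro sum.cong refl) (simp add: singular_value_square[OF diag])
  finally show ?thesis by (simp add: b_def)
qed

lemma trailing_slice_carrier:
  "A \<in> carrier_tensor (Is @ Js) \<Longrightarrow> k \<in> multi_indices Js \<Longrightarrow> trailing_slice A k \<in> carrier_tensor Is"
  by (simp add: trailing_slice_def carrier_tensor_def length_multi_indices)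

lemma entry_trailing_slice:
  "A \<in> carrier_tensor (Is @ Js) \<Longrightarrow> k \<in> multi_indices Js \<Longrightarrow> i \<in> multi_indices Is \<Longrightarrow>
    entry (trailing_slice A k) i = column A k i"
  by (simp add: trailing_slice_def carrier_tensor_def length_multi_indices entry_tensor column_def)

section \<open>The ONPP objective\<close>

text \<open>Modes are counted from 1, so \<open>Suc (length Is)\<close> is the trailing mode, at
  position \<open>length Is\<close> of the index list.\<close>

lemma column_mode_product_last:
  assumes X: "X \<in> carrier_tensor (Is @ [n])" and U: "U \<in> carrier_mat n n"
    and i: "i \<in> multi_indices Is" and c: "c < n"
  shows "column (mode_product X (Suc (length Is)) U) [c] i = (\<Sum>j<n. U $$ (c, j) * column X [j] i)"
proof -
  have "i @ [c] \<in> multi_indices (Is @ [n])"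
    using c by (intro multi_indices_append i) (simp add: multi_indices_single)
  then show ?thesis
    using X U length_multi_indices[OF i]
    by (simp add: column_def mode_product_def carrier_tensor_def entry_tensor nth_append list_update_append)
qed

lemma mode_product_last_carrier:
  "X \<in> carrier_tensor (Is @ [n]) \<Longrightarrow> U \<in> carrier_mat n n \<Longrightarrow>
    mode_product X (Suc (length Is)) U \<in> carrier_tensor (Is @ [n])"
  by (simp add: mode_product_def carrier_tensor_def list_update_append)

text \<open>The objective is the squared Frobenius norm of \<open>Y (I - W)\<^sup>T\<close>.\<close>

lemma onpp_objective_eq:
  assumes Y: "Y \<in> carrier_tensor [d, n]" and W: "W \<in> carrier_mat n n"
  shows "onpp_objective n W Y =
    (\<Sum>c<n. \<Sum>k\<in>multi_indices [d]. (\<Sum>j<n. (1\<^sub>m n - W) $$ (c, j) * entry Y (k @ [j]))\<^sup>2)"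
  unfolding onpp_objective_def
proof (intro sum.cong refl)
  fix c assume c: "c \<in> {..<n}"
  have Y': "Y \<in> carrier_tensor ([d] @ [n])" using Y by simp
  have slice: "entry (frontal_slice Y j) k = entry Y (k @ [j])"
    "dims (frontal_slice Y j) = [d]" if "j < n" "k \<in> multi_indices [d]" for j k
  proof -
    have j: "[j] \<in> multi_indices [n]" using that by (simp add: multi_indices_single)
    show "entry (frontal_slice Y j) k = entry Y (k @ [j])" "dims (frontal_slice Y j) = [d]"
      using entry_trailing_slice[OF Y' j that(2)] trailing_slice_carrier[OF Y' j]
      by (simp_all add: frontal_slice_def column_def carrier_tensor_def)
  qed
  have dim: "dims (frontal_slice Y c) = [d]"
    using trailing_slice_carrier[OF Y', of "[c]"] c
    by (simp add: frontal_slice_def carrier_tensor_def multi_indices_single)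
  let ?R = "minus_tensor (frontal_slice Y c) (sum_tensor (butlast (dims Y))
     (\<lambda>j. scale_tensor (W $$ (c, j)) (frontal_slice Y j)) {..<n})"
  have "entry ?R k = (\<Sum>j<n. (1\<^sub>m n - W) $$ (c, j) * entry Y (k @ [j]))"
    if k: "k \<in> multi_indices [d]" for k
  proof -
    have "entry ?R k = entry Y (k @ [c]) - (\<Sum>j<n. W $$ (c, j) * entry Y (k @ [j]))"
      using Y c k by (simp add: minus_tensor_def sum_tensor_def scale_tensor_def entry_tensor
          dim slice carrier_tensor_def)
    \<comment> \<open>The single entry is written as a sum over \<open>j\<close> so that it merges
      with the weighted sum into the coefficients of \<open>1\<^sub>m n - W\<close>.\<close>
    also have "entry Y (k @ [c]) = (\<Sum>j<n. of_bool (j = c) * entry Y (k @ [j]))"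
      using c by (simp add: of_bool_def if_distrib [of "\<lambda>x. x * _"] cong: if_cong)
    finally show ?thesis
      unfolding sum_subtractf[symmetric]
      by (simp only:) (intro sum.cong refl, use W c in \<open>auto simp: left_diff_distrib of_bool_def\<close>)
  qed
  then show "(frobenius_norm ?R)\<^sup>2 =
      (\<Sum>k\<in>multi_indices [d]. (\<Sum>j<n. (1\<^sub>m n - W) $$ (c, j) * entry Y (k @ [j]))\<^sup>2)"
    unfolding frobenius_norm_def by (simp add: minus_tensor_def dim sum_nonneg)
qed

text \<open>The transpose of \<open>P\<close> contracts the leading modes while
  \<open>1\<^sub>m n - W\<close> acts on the last one, so the two operations commute.\<close>

lemma onpp_value_eq:
  assumes X: "X \<in> carrier_tensor (Is @ [n])" and W: "W \<in> carrier_mat n n"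
    and P: "P \<in> carrier_tensor (Is @ [d])"
  defines "A \<equiv> mode_product X (Suc (length Is)) (1\<^sub>m n - W)"
  shows "onpp_value Is n X W P =
    (\<Sum>k\<in>multi_indices [d]. \<Sum>c\<in>multi_indices [n].
      (ip (multi_indices Is) (column P k) (column A c))\<^sup>2)"
proof -
  let ?Y = "einstein_product (length Is) (transpose_tensor (length Is) P) X"
  note T = transpose_tensor_carrier[OF P]
  have Y: "?Y \<in> carrier_tensor [d, n]"
    using einstein_product_carrier[OF T X] by simp
  have M: "1\<^sub>m n - W \<in> carrier_mat n n" using W by (rule minus_carrier_mat)
  have entry: "entry ?Y (k @ [j]) = ip (multi_indices Is) (column P k) (column X [j])"
    if k: "k \<in> multi_indices [d]" and "j < n" for k j
  proof -
    have j: "[j] \<in> multi_indices [n]" using \<open>j < n\<close> by (simp add: multi_indices_single)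
    show ?thesis
      unfolding entry_einstein_product[OF T X k j] ip_def column_def
      by (intro sum.cong refl) (simp add: entry_transpose_tensor[OF P] k)
  qed
  have "(\<Sum>j<n. (1\<^sub>m n - W) $$ (c, j) * entry ?Y (k @ [j])) =
      ip (multi_indices Is) (column P k) (column A [c])"
    if k: "k \<in> multi_indices [d]" and c: "c < n" for k c
  proof -
    have "ip (multi_indices Is) (column P k) (column A [c]) =
        ip (multi_indices Is) (column P k) (\<lambda>i. \<Sum>j<n. (1\<^sub>m n - W) $$ (c, j) * column X [j] i)"
      unfolding A_def by (intro ip_cong refl column_mode_product_last[OF X M _ c])
    also have "\<dots> = (\<Sum>j<n. (1\<^sub>m n - W) $$ (c, j) * entry ?Y (k @ [j]))"
      unfolding ip_sum_right ip_scale_right by (intro sum.cong refl) (simp add: entry k)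
    finally show ?thesis by simp
  qed
  then have "onpp_value Is n X W P =
      (\<Sum>c<n. \<Sum>k\<in>multi_indices [d]. (ip (multi_indices Is) (column P k) (column A [c]))\<^sup>2)"
    unfolding onpp_value_def onpp_objective_eq[OF Y W] by (intro sum.cong refl) simp
  then show ?thesis
    by (subst sum.swap) (simp add: sum_multi_indices_single[of _ n])
qed

lemma onpp_feasible_iff:
  "onpp_feasible Is d P \<longleftrightarrow> P \<in> carrier_tensor (Is @ [d]) \<and>
     orthonormal_on (multi_indices [d]) (multi_indices Is) (column P)"
  unfolding onpp_feasible_def using transpose_product_eq_id_iff by blast

section \<open>Optimality of the smallest singular values\<close>

text \<open>Adding a minimal element of the rest keeps the set a smallest one.\<close>

lemma ex_smallest_subset:
  fixes x :: "'a \<Rightarrow> 'b::linorder"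
  assumes "finite I" "d \<le> card I"
  shows "\<exists>T\<subseteq>I. card T = d \<and> (\<forall>a\<in>T. \<forall>b\<in>I - T. x a \<le> x b)"
  using assms(2)
proof (induction d)
  case 0
  then show ?case by (intro exI[of _ "{}"]) simp
next
  case (Suc d)
  then obtain T where T: "T \<subseteq> I" "card T = d" "\<And>a b. a \<in> T \<Longrightarrow> b \<in> I - T \<Longrightarrow> x a \<le> x b"
    by (metis Suc_leD)
  have "I - T \<noteq> {}"
    using T Suc by (metis Diff_eq_empty_iff Suc_n_not_le_n subset_antisym)
  then obtain e where e: "e \<in> I - T" "\<And>b. b \<in> I - T \<Longrightarrow> x e \<le> x b"
    using ex_min_if_finite[of "x ` (I - T)"] assms(1) by (auto simp: not_less)
  have "card (insert e T) = Suc d"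
    using T e assms(1) finite_subset by (metis DiffD2 card_insert_disjoint)
  then show ?case
    using T e by (intro exI[of _ "insert e T"]) auto
qed

text \<open>The weight missing from \<open>T\<close> equals the weight placed outside
  \<open>T\<close>, and moving it there cannot lower the sum.\<close>

lemma weighted_sum_ge_smallest:
  fixes x t :: "'a \<Rightarrow> real"
  assumes "finite I" "T \<subseteq> I" "T \<noteq> {}"
    and t: "\<And>i. i \<in> I \<Longrightarrow> 0 \<le> t i" "\<And>i. i \<in> I \<Longrightarrow> t i \<le> 1" "(\<Sum>i\<in>I. t i) = card T"
    and x: "\<And>a b. a \<in> T \<Longrightarrow> b \<in> I - T \<Longrightarrow> x a \<le> x b"
  shows "(\<Sum>i\<in>T. x i) \<le> (\<Sum>i\<in>I. x i * t i)"
proof -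
  \<comment> \<open>A threshold between the values on \<open>T\<close> and those outside; the
    maximum exists because \<open>T\<close> is nonempty, which later comes from
    \<open>1 \<le> d\<close>.\<close>
  define m where "m = Max (x ` T)"
  have T: "finite T" using assms finite_subset by blast
  have le: "x i \<le> m" if "i \<in> T" for i
    using T that by (simp add: m_def)
  have ge: "m \<le> x i" if "i \<in> I - T" for i
    using T assms(3) x that by (simp add: m_def)
  have "(\<Sum>i\<in>T. x i) - (\<Sum>i\<in>T. x i * t i) = (\<Sum>i\<in>T. x i * (1 - t i))"
    by (simp add: sum_subtractf right_diff_distrib)
  also have "\<dots> \<le> (\<Sum>i\<in>T. m * (1 - t i))"
    by (intro sum_mono mult_right_mono le) (use t(2) assms(2) in auto)
  also have "\<dots> = m * (card T - (\<Sum>i\<in>T. t i))"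
    by (simp add: sum_subtractf sum_distrib_left[symmetric] mult.commute)
  also have "\<dots> = m * (\<Sum>i\<in>I - T. t i)"
    using sum.subset_diff[OF assms(2,1), of t] t(3) by simp
  also have "\<dots> = (\<Sum>i\<in>I - T. m * t i)"
    by (rule sum_distrib_left)
  also have "\<dots> \<le> (\<Sum>i\<in>I - T. x i * t i)"
    by (intro sum_mono mult_right_mono ge) (use t(1) in auto)
  finally show ?thesis
    using sum.subset_diff[OF assms(2,1), of "\<lambda>i. x i * t i"] by simp
qed

text \<open>The weight of the singular value at \<open>j\<close> is the squared length of the projection of the
  corresponding left singular tensor to the span of the frontal slices of \<open>P\<close>.\<close>

lemma onpp_value_esvd:
  assumes "X \<in> carrier_tensor (Is @ [n])" "W \<in> carrier_mat n n" "P \<in> carrier_tensor (Is @ [d])"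
    and "is_esvd Is [n] (mode_product X (Suc (length Is)) (1\<^sub>m n - W)) U S V"
  shows "onpp_value Is n X W P = (\<Sum>j\<in>multi_indices Is. (singular_value [n] S j)\<^sup>2 *
    (\<Sum>k\<in>multi_indices [d]. (ip (multi_indices Is) (column P k) (column U j))\<^sup>2))"
  unfolding onpp_value_eq[OF assms(1-3)] esvd_quadratic_form[OF assms(4)]
  by (subst sum.swap) (simp add: sum_distrib_left)

lemma onpp_value_ge:
  assumes X: "X \<in> carrier_tensor (Is @ [n])" and W: "W \<in> carrier_mat n n"
    and Q: "onpp_feasible Is d Q"
    and svd: "is_esvd Is [n] (mode_product X (Suc (length Is)) (1\<^sub>m n - W)) U S V"
    and T: "T \<subseteq> multi_indices Is" "card T = d" "T \<noteq> {}"
      "\<And>a b. a \<in> T \<Longrightarrow> b \<in> multi_indices Is - T \<Longrightarrow> singular_value [n] S a \<le> singular_value [n] S b"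
  shows "(\<Sum>j\<in>T. (singular_value [n] S j)\<^sup>2) \<le> onpp_value Is n X W Q"
proof -
  let ?I = "multi_indices Is" and ?D = "multi_indices [d]"
  have Qc: "Q \<in> carrier_tensor (Is @ [d])" and Qo: "orthonormal_on ?D ?I (column Q)"
    using Q by (auto simp: onpp_feasible_iff)
  have U: "orthonormal_on ?I ?I (column U)"
    using svd by (auto simp: is_esvd_def unitary_tensor_iff)
  define t where "t j = (\<Sum>k\<in>?D. (ip ?I (column Q k) (column U j))\<^sup>2)" for j
  \<comment> \<open>Bessel for the family of slices of \<open>Q\<close>, applied to the unit vector
    \<open>column U j\<close>.\<close>
  have "t j \<le> 1" if "j \<in> ?I" for j
    using bessel[OF Qo, of "column U j"] orthonormal_onD[OF U that that]
    by (simp add: t_def ip_commute[of ?I "column Q _"])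
  moreover have "(\<Sum>j\<in>?I. t j) = card T"
  proof -
    \<comment> \<open>With the sums swapped the roles change: each slice of \<open>Q\<close> is a
      unit vector expanded in the basis \<open>U\<close>.\<close>
    have "(\<Sum>j\<in>?I. t j) = (\<Sum>k\<in>?D. ip ?I (column Q k) (column Q k))"
      unfolding t_def by (subst sum.swap) (simp add: parseval[OF U])
    also have "\<dots> = (\<Sum>k\<in>?D. 1)"
      by (intro sum.cong refl) (simp add: orthonormal_onD[OF Qo])
    finally show ?thesis by (simp add: card_multi_indices T(2))
  qed
  \<comment> \<open>Singular values are nonnegative, so their squares are ordered in the same
    way.\<close>
  moreover have "(singular_value [n] S a)\<^sup>2 \<le> (singular_value [n] S b)\<^sup>2" if "a \<in> T" "b \<in> ?I - T" for a b
    using T singular_value_nonneg[OF svd] that by (intro power_mono) auto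
  ultimately show ?thesis
    unfolding onpp_value_esvd[OF X W Qc svd] t_def[symmetric]
    using T by (intro weighted_sum_ge_smallest) (auto simp: t_def sum_nonneg)
qed

text \<open>Ensures that the optimality claim is not vacuous. The bound on \<open>d\<close> provides
  enough multi-indices to choose from.\<close>

lemma ex_smallest_left_singular:
  assumes A: "A \<in> carrier_tensor (Is @ Ks)" and d: "d \<le> prod_list Is"
  shows "\<exists>P. smallest_left_singular Is Ks d A P"
proof -
  obtain U S V where svd: "is_esvd Is Ks A U S V"
    using ex_esvd[OF A] by blast
  then have U: "U \<in> carrier_tensor (Is @ Is)"
    by (simp add: is_esvd_def unitary_tensor_def)
  obtain T where T: "T \<subseteq> multi_indices Is" "card T = d"
    "\<And>a b. a \<in> T \<Longrightarrow> b \<in> multi_indices Is - T \<Longrightarrow> singular_value Ks S a \<le> singular_value Ks S b"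
    using ex_smallest_subset[of "multi_indices Is" d "singular_value Ks S"] d
    by (auto simp: card_multi_indices)
  have "finite T" using T(1) by (rule finite_subset) simp
  then obtain \<sigma> where \<sigma>: "bij_betw \<sigma> {..<d} T"
    using ex_bij_betw_nat_finite[of T] T(2) by (auto simp: lessThan_atLeast0)
  then have \<sigma>': "inj_on \<sigma> {..<d}" "\<sigma> ` {..<d} = T"
    by (auto simp: bij_betw_def)
  \<comment> \<open>Here \<open>k\<close> is a multi-index of length one, and \<open>hd k\<close> is
    the number of the slice.\<close>
  define P where "P = tensor_of_fun2 Is [d] (\<lambda>i k. column U (\<sigma> (hd k)) i)"
  have P: "P \<in> carrier_tensor (Is @ [d])"
    by (simp add: P_def tensor_of_fun2_carrier)
  have "frontal_slice P k = trailing_slice U (\<sigma> k)" if "k < d" for k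
  proof -
    have k: "[k] \<in> multi_indices [d]" "\<sigma> k \<in> multi_indices Is"
      using that \<sigma>' T(1) by (auto simp: multi_indices_single)
    show ?thesis
      unfolding frontal_slice_def
    proof (rule tensor_eqI)
      show "dims (trailing_slice P [k]) = dims (trailing_slice U (\<sigma> k))"
        using trailing_slice_carrier[OF P k(1)] trailing_slice_carrier[OF U k(2)]
        by (simp add: carrier_tensor_def)
      fix i assume "i \<in> multi_indices (dims (trailing_slice P [k]))"
      then have i: "i \<in> multi_indices Is"
        using trailing_slice_carrier[OF P k(1)] by (simp add: carrier_tensor_def)
      show "entry (trailing_slice P [k]) i = entry (trailing_slice U (\<sigma> k)) i"
        unfolding entry_trailing_slice[OF P k(1) i] entry_trailing_slice[OF U k(2) i]
        by (simp add: P_def column_def[of "tensor_of_fun2 _ _ _"] entry_tensor_of_fun2 i k)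
    qed
  qed
  then have "smallest_left_singular Is Ks d A P"
    unfolding smallest_left_singular_def
    using P svd \<sigma>' T by (intro conjI exI[of _ U] exI[of _ S] exI[of _ V] exI[of _ \<sigma>]) auto
  then show ?thesis by blast
qed

lemma smallest_left_singular_solution:
  assumes X: "X \<in> carrier_tensor (Is @ [n])" and W: "W \<in> carrier_mat n n" and d: "1 \<le> d"
    and P: "smallest_left_singular Is [n] d (mode_product X (Suc (length Is)) (1\<^sub>m n - W)) P"
  shows "onpp_solution Is n d X W P"
proof -
  let ?I = "multi_indices Is" and ?D = "multi_indices [d]"
  obtain U S V \<sigma> where Pc: "P \<in> carrier_tensor (Is @ [d])"
    and svd: "is_esvd Is [n] (mode_product X (Suc (length Is)) (1\<^sub>m n - W)) U S V"
    and inj: "inj_on \<sigma> {..<d}" and sub: "\<sigma> ` {..<d} \<subseteq> ?I"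
    and min: "\<forall>k<d. \<forall>is\<in>?I - \<sigma> ` {..<d}. singular_value [n] S (\<sigma> k) \<le> singular_value [n] S is"
    and slice: "\<forall>k<d. frontal_slice P k = trailing_slice U (\<sigma> k)"
    using P unfolding smallest_left_singular_def by blast
  have Uc: "U \<in> carrier_tensor (Is @ Is)" and U: "orthonormal_on ?I ?I (column U)"
    using svd by (auto simp: is_esvd_def unitary_tensor_iff)
  have col: "column P [k] i = column U (\<sigma> k) i" if "k < d" "i \<in> ?I" for k i
  proof -
    have k: "[k] \<in> ?D" "\<sigma> k \<in> ?I"
      using that sub by (auto simp: multi_indices_single)
    show ?thesis
      using entry_trailing_slice[OF Pc k(1) that(2)] entry_trailing_slice[OF Uc k(2) that(2)]
        slice that(1) by (simp add: frontal_slice_def)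
  qed
  have ip_col: "ip ?I (column P [k]) y = ip ?I (column U (\<sigma> k)) y"
    "ip ?I y (column P [k]) = ip ?I y (column U (\<sigma> k))" if "k < d" for k y
    by (auto intro!: ip_cong simp: col that)
  have \<sigma>: "\<sigma> k \<in> ?I" if "k < d" for k
    using sub that by auto
  have feasible: "onpp_feasible Is d P"
    unfolding onpp_feasible_iff orthonormal_on_def multi_indices_single
    using Pc inj by (auto simp: ip_col orthonormal_onD[OF U] \<sigma> inj_on_def)
  \<comment> \<open>The slices of \<open>P\<close> are themselves columns of \<open>U\<close>, so
    every weight is 0 or 1 and the lower bound is attained.\<close>
  have weight: "(\<Sum>k\<in>?D. (ip ?I (column P k) (column U j))\<^sup>2) = of_bool (j \<in> \<sigma> ` {..<d})"
    if j: "j \<in> ?I" for j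
  proof -
    have "(\<Sum>k\<in>?D. (ip ?I (column P k) (column U j))\<^sup>2) = (\<Sum>k<d. of_bool (\<sigma> k = j))"
      unfolding sum_multi_indices_single
      by (intro sum.cong refl) (simp add: ip_col orthonormal_onD[OF U] \<sigma> j)
    \<comment> \<open>Injectivity of \<sigma> ensures that no left singular tensor is counted
      twice.\<close>
    also have "\<dots> = (\<Sum>i\<in>\<sigma> ` {..<d}. of_bool (i = j))"
      by (simp add: sum.reindex[OF inj])
    also have "\<dots> = of_bool (j \<in> \<sigma> ` {..<d})"
      by (simp add: of_bool_def)
    finally show ?thesis .
  qed
  have "onpp_value Is n X W P =
      (\<Sum>j\<in>?I. if j \<in> \<sigma> ` {..<d} then (singular_value [n] S j)\<^sup>2 else 0)"
    unfolding onpp_value_esvd[OF X W Pc svd] by (intro sum.cong refl) (simp add: weight)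
  also have "\<dots> = (\<Sum>j\<in>\<sigma> ` {..<d}. (singular_value [n] S j)\<^sup>2)"
    using sub by (simp add: sum.inter_restrict[symmetric] Int_absorb1)
  finally have "onpp_value Is n X W P = (\<Sum>j\<in>\<sigma> ` {..<d}. (singular_value [n] S j)\<^sup>2)" .
  moreover have "(\<Sum>j\<in>\<sigma> ` {..<d}. (singular_value [n] S j)\<^sup>2) \<le> onpp_value Is n X W Q"
    if "onpp_feasible Is d Q" for Q
  proof (rule onpp_value_ge[OF X W that svd sub])
    show "card (\<sigma> ` {..<d}) = d" "\<sigma> ` {..<d} \<noteq> {}"
      using d by (auto simp: card_image[OF inj] lessThan_empty_iff)
  qed (use min in blast)
  ultimately show ?thesis
    unfolding onpp_solution_def using feasible by simp
qed

theorem mainTheorem2: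
  fixes Is :: "nat list" and n d :: nat and X :: tensor and W :: "real mat"
  assumes "X \<in> carrier_tensor (Is @ [n])"
    and "W \<in> carrier_mat n n"
    and "1 \<le> d" and "d \<le> prod_list Is"
  shows "(\<exists>P. smallest_left_singular Is [n] d
              (mode_product X (Suc (length Is)) (1\<^sub>m n - W)) P) \<and>
         (\<forall>P. smallest_left_singular Is [n] d
              (mode_product X (Suc (length Is)) (1\<^sub>m n - W)) P \<longrightarrow>
            onpp_solution Is n d X W P)"
  using ex_smallest_left_singular[OF mode_product_last_carrier] smallest_left_singular_solution assms
  by (metis minus_carrier_mat)

end
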